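(* Let $d\ge 2$ be an integer and let $R_1(z)=\sum_j(z-\lambda_j)_+$ be the first Riesz-mean of the Laplacian eigenvalues $\lambda_j$ (counted with multiplicity) on $\mathbb{S}^d$. For $z\geq 0$ let $w\ge0$ be defined by $w(w+d-1)=z$. As $z\to+\infty$, $$ \frac{R_1(z)}{L_{1,d}^{class}|\mathbb{S}^d|\,z^{\frac d2+1}}=1+\frac{d(d+2)}{12}\left(d-2+6\left(\frac14-\psi^2(w)\right)\right)z^{-1}+o(z^{-1}). $$
   Context: $\mathbb{S}^d$ is the round unit sphere in $\mathbb{R}^{d+1}$. The distinct eigenvalues (energy levels) of $-\Delta$ on $\mathbb{S}^d$ are $\lambda_{(l)}=l(l+d-1)$, $l\in\mathbb{N}=\{0,1,2,\dots\}$, with multiplicity $m_{l,d}=\binom{d+l}{l}-\binom{d+l-2}{l-2}$ (a binomial coefficient with negative lower entry being $0$); $a_+=\max(a,0)$. The semiclassical constant is $L_{\gamma,d}^{class}=(4\pi)^{-d/2}\frac{\Gamma(\gamma+1)}{\Gamma(\gamma+1+d/2)}$, so $L_{1,d}^{class}|\mathbb{S}^d|=\frac{4}{(d+2)\,d!}$. The fluctuation function is $\psi(\eta)=\eta-\lfloor\eta\rfloor-\frac12$, $\eta\geq0$; $\psi^2(w)=(\psi(w))^2$. *)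

theory Defs
  imports "HOL-Analysis.Analysis"
begin

section \<open>The spectrum of the Laplacian on the round unit sphere of dimension d\<close>

definition sphere_level :: "nat \<Rightarrow> nat \<Rightarrow> real" where
  "sphere_level d l = real l * (real l + real d - 1)"

text \<open>
  The case distinction implements the convention that a binomial coefficient with negative
  lower entry vanishes. For d at least 1 the outer subtraction never truncates, see
  \<open>sphere_mult_int\<close> below.
\<close>

definition sphere_mult :: "nat \<Rightarrow> nat \<Rightarrow> nat" where
  "sphere_mult d l =
     (d + l choose l) - (if l < 2 then 0 else (d + l - 2 choose (l - 2)))"

text \<open>
  The eigenvalues repeated according to multiplicity, in nondecreasing order and indexed
  from 0: the first \<open>sphere_mult d 0\<close> of them are \<open>sphere_level d 0\<close>, the next
  \<open>sphere_mult d 1\<close> are \<open>sphere_level d 1\<close>, and so on. That each level is attained exactly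
  as often as its multiplicity prescribes is proved in \<open>card_sphere_eigenvalue\<close>.
\<close>

definition sphere_eigenvalue :: "nat \<Rightarrow> nat \<Rightarrow> real" where
  "sphere_eigenvalue d j = sphere_level d (LEAST l. j < (\<Sum>k\<le>l. sphere_mult d k))"

lemma sphere_mult_less:
  assumes "d \<ge> 1"
  shows "(if l < 2 then 0 else (d + l - 2 choose (l - 2))) < (d + l choose l)"
proof (cases "l < 2")
  case True
  then show ?thesis by simp
next
  case False
  then have "l = Suc (Suc (l - 2))" by simp
  then obtain n where l: "l = Suc (Suc n)" ..
  have "(d + n choose n) \<le> (d + Suc n choose Suc n)"
    by simp
  moreover have "0 < (d + Suc n choose Suc (Suc n))"
    using assms by simp
  ultimately have "(d + n choose n) < (d + Suc (Suc n) choose Suc (Suc n))"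
    by simp
  then show ?thesis
    by (simp add: l)
qed

lemma sphere_mult_pos: "d \<ge> 1 \<Longrightarrow> sphere_mult d l > 0"
  using sphere_mult_less[of d l] by (simp add: sphere_mult_def)

lemma sphere_mult_int:
  assumes "d \<ge> 1"
  shows "int (sphere_mult d l) =
    int (d + l choose l) - (if l < 2 then 0 else int (d + l - 2 choose (l - 2)))"
  using sphere_mult_less[OF assms, of l] by (auto simp: sphere_mult_def split: if_splits)

lemma sphere_level_inject:
  assumes "d \<ge> 1"
  shows "sphere_level d k = sphere_level d l \<longleftrightarrow> k = l"
proof
  have less: "sphere_level d a < sphere_level d b" if "a < b" for a b
  proof -
    have "real a * (real a + real d - 1) \<le> real a * (real b + real d - 1)"
      using that by (intro mult_left_mono) auto
    also have "\<dots> < real b * (real b + real d - 1)"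
      using that assms by (intro mult_strict_right_mono) auto
    finally show ?thesis
      by (simp add: sphere_level_def)
  qed
  show "k = l" if "sphere_level d k = sphere_level d l"
    using that less[of k l] less[of l k] by (cases k l rule: linorder_cases) auto
qed auto

lemma card_sphere_eigenvalue:
  assumes "d \<ge> 1"
  shows "card {j. sphere_eigenvalue d j = sphere_level d l} = sphere_mult d l"
proof -
  define S where "S l = (\<Sum>k\<le>l. sphere_mult d k)" for l
  define B where "B = (\<Sum>k<l. sphere_mult d k)"
  have Sl: "S l = B + sphere_mult d l"
    unfolding S_def B_def by (metis lessThan_Suc_atMost sum.lessThan_Suc)
  have ge: "l < S l" for l
    using sum_mono[of "{..l}" "\<lambda>_. 1" "sphere_mult d"] sphere_mult_pos[OF assms]
    by (simp add: S_def Suc_le_eq)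
  have mono: "S a \<le> S b" if "a \<le> b" for a b
    unfolding S_def using that by (intro sum_mono2) auto
  have B_le: "S k \<le> B" if "k < l" for k
    unfolding S_def B_def using that by (intro sum_mono2) auto
  have "(LEAST l. j < S l) = l \<longleftrightarrow> j \<in> {B..<S l}" for j
  proof
    assume eq: "(LEAST l. j < S l) = l"
    have "j < S l"
      using LeastI[of "\<lambda>l. j < S l" j] ge[of j] eq by simp
    moreover have "B \<le> j"
    proof (cases l)
      case 0
      then show ?thesis by (simp add: B_def)
    next
      case (Suc n)
      then have "\<not> j < S n"
        using not_less_Least[of n "\<lambda>l. j < S l"] eq by simp
      moreover have "S n = B"
        by (simp add: S_def B_def Suc lessThan_Suc_atMost)
      ultimately show ?thesis by simp
    qed
    ultimately show "j \<in> {B..<S l}" by simp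
  next
    assume j: "j \<in> {B..<S l}"
    show "(LEAST l. j < S l) = l"
    proof (rule Least_equality)
      show "j < S l" using j by simp
      show "l \<le> k" if "j < S k" for k
        using that j B_le[of k] by (cases "k < l") auto
    qed
  qed
  then have "{j. sphere_eigenvalue d j = sphere_level d l} = {B..<S l}"
    unfolding sphere_eigenvalue_def sphere_level_inject[OF assms] S_def[symmetric] by blast
  then show ?thesis
    by (simp add: Sl)
qed

section \<open>Riesz mean, semiclassical constant and fluctuation function\<close>

text \<open>For d at least 1 only finitely many terms of this series are nonzero.\<close>

definition riesz_mean_1 :: "nat \<Rightarrow> real \<Rightarrow> real" where
  "riesz_mean_1 d z = (\<Sum>j. max (z - sphere_eigenvalue d j) 0)"

lemma finite_riesz_mean_1_support:
  assumes "d \<ge> 1"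
  shows "finite {j. max (z - sphere_eigenvalue d j) 0 \<noteq> 0}"
proof -
  have level_less: "l \<le> nat \<lceil>z\<rceil> + 1" if "sphere_level d l < z" for l
  proof (cases "l = 0")
    case False
    have "real l * 1 \<le> real l * (real l + real d - 1)"
      using assms False by (intro mult_left_mono) auto
    then have "real l < z"
      using that by (simp add: sphere_level_def)
    then show ?thesis by linarith
  qed simp
  have "{j. max (z - sphere_eigenvalue d j) 0 \<noteq> 0} \<subseteq>
      (\<Union>l\<le>nat \<lceil>z\<rceil> + 1. {j. sphere_eigenvalue d j = sphere_level d l})"
  proof
    fix j
    define l where "l = (LEAST l. j < (\<Sum>k\<le>l. sphere_mult d k))"
    assume "j \<in> {j. max (z - sphere_eigenvalue d j) 0 \<noteq> 0}"
    then have "sphere_eigenvalue d j < z"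
      by (simp add: max_def split: if_splits)
    moreover have ev: "sphere_eigenvalue d j = sphere_level d l"
      by (simp add: sphere_eigenvalue_def l_def)
    ultimately have "l \<le> nat \<lceil>z\<rceil> + 1"
      by (intro level_less) simp
    with ev show "j \<in> (\<Union>l\<le>nat \<lceil>z\<rceil> + 1. {j. sphere_eigenvalue d j = sphere_level d l})"
      by blast
  qed
  moreover have "finite {j. sphere_eigenvalue d j = sphere_level d l}" for l
    using card_sphere_eigenvalue[OF assms, of l] sphere_mult_pos[OF assms, of l]
    by (metis card.infinite less_not_refl)
  ultimately show ?thesis
    by (rule finite_subset[OF _ finite_UN_I[OF finite_atMost]])
qed

definition L_class :: "real \<Rightarrow> nat \<Rightarrow> real" where
  "L_class \<gamma> d =
     (4 * pi) powr (- (real d / 2)) * (Gamma (\<gamma> + 1) / Gamma (\<gamma> + 1 + real d / 2))"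

text \<open>
  The d-dimensional surface measure of the unit sphere in dimension d + 1, expressed through
  the volume of the ball it bounds (the ball of radius r has volume \<open>r ^ (d + 1)\<close> times that
  of the unit ball; differentiate at r = 1).
\<close>

definition sphere_volume :: "nat \<Rightarrow> real" where
  "sphere_volume d = (real d + 1) * unit_ball_vol (real d + 1)"

lemma L_class_1_sphere_volume:
  "L_class 1 d * sphere_volume d = 4 / ((real d + 2) * fact d)"
proof -
  define x where "x = real d / 2"
  have x: "x \<ge> 0" "real d = 2 * x"
    by (auto simp: x_def)
  have pos1: "x + 1 \<notin> \<int>\<^sub>\<le>\<^sub>0" and pos2: "x + 1/2 \<notin> \<int>\<^sub>\<le>\<^sub>0"
    using x by (auto elim!: nonpos_Ints_cases)
  have dup: "Gamma (x + 1/2) * Gamma (x + 1) = 2 powr (- 2 * x) * sqrt pi * fact d"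
  proof -
    have "complex_of_real (x + 1/2) \<notin> \<int>\<^sub>\<le>\<^sub>0" "complex_of_real (x + 1/2) + 1/2 \<notin> \<int>\<^sub>\<le>\<^sub>0"
      using x by (auto elim!: nonpos_Ints_cases simp: complex_eq_iff)
    from Gamma_legendre_duplication[OF this]
    have "complex_of_real (Gamma (x + 1/2) * Gamma (x + 1)) =
        complex_of_real (exp (- 2 * x * ln 2) * sqrt pi * Gamma (2 * x + 1))"
      by (simp add: Gamma_complex_of_real[symmetric] exp_of_real[symmetric] algebra_simps)
    then have "Gamma (x + 1/2) * Gamma (x + 1) = exp (- 2 * x * ln 2) * sqrt pi * Gamma (2 * x + 1)"
      by (simp only: of_real_eq_iff)
    then show ?thesis
      using Gamma_fact[of d, where 'a = real] x by (simp add: powr_def add.commute)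
  qed
  have G2: "Gamma (2 + x) = (x + 1) * Gamma (x + 1)"
    using Gamma_plus1[of "x + 1"] pos1 by (simp add: add_ac)
  have G3: "Gamma (x + 1/2 + 1) = (x + 1/2) * Gamma (x + 1/2)"
    using pos2 by (intro Gamma_plus1) auto
  define g where "g = Gamma (x + 1/2)"
  define h where "h = Gamma (x + 1)"
  define q where "q = (2::real) powr (- 2 * x)"
  have gh: "g * h = q * sqrt pi * fact d"
    using dup by (simp only: g_def h_def q_def)
  have q: "q > 0"
    by (simp add: q_def)
  have "sphere_volume d = (2 * (x + 1/2)) * (pi powr (x + 1/2) / ((x + 1/2) * g))"
  proof -
    have "(real d + 1) / 2 = x + 1/2" and "real d + 1 = 2 * (x + 1/2)"
      using x by auto
    then show ?thesis
      unfolding sphere_volume_def unit_ball_vol_def g_def G3[symmetric] by metis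
  qed
  also have "\<dots> = 2 * pi powr (x + 1/2) / g"
  proof -
    have "(2 * y) * (p / (y * g)) = 2 * p / g" if "y > 0" for y p :: real
      using that by simp
    then show ?thesis
      using x by (metis add_nonneg_pos half_gt_zero zero_less_one)
  qed
  finally have vol: "sphere_volume d = 2 * pi powr (x + 1/2) / g" .
  have "L_class 1 d = (4 * pi) powr (- x) * (1 / ((x + 1) * h))"
  proof -
    have "real d / 2 = x" and "1 + 1 + x = 2 + x" and "Gamma (1 + 1) = (1::real)"
      using Gamma_fact[of 1, where 'a = real] by (simp_all add: x_def)
    then show ?thesis
      unfolding L_class_def h_def G2[symmetric] by metis
  qed
  also have "(4 * pi) powr (- x) = q * pi powr (- x)"
    using powr_powr[of "2::real" 2 "- x"] by (simp add: powr_mult q_def)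
  finally have "L_class 1 d * sphere_volume d =
      q * (pi powr (- x) * pi powr (x + 1/2)) * 2 / ((x + 1) * (g * h))"
    unfolding vol by (simp add: mult_ac)
  also have "pi powr (- x) * pi powr (x + 1/2) = sqrt pi"
    unfolding powr_add[symmetric] by (simp add: powr_half_sqrt)
  also have "q * sqrt pi * 2 / ((x + 1) * (g * h)) = 2 / ((x + 1) * fact d)"
    unfolding gh using q by simp
  also have "\<dots> = 4 / ((real d + 2) * fact d)"
  proof -
    have "real d + 2 = 2 * (x + 1)"
      using x by simp
    then have "(real d + 2) * fact d = 2 * ((x + 1) * fact d)"
      by (simp only: mult.assoc)
    moreover have "2 / u = 4 / (2 * u)" for u :: real
      by simp
    ultimately show ?thesis by metis
  qed
  finally show ?thesis .
qed

definition fluct :: "real \<Rightarrow> real" where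
  "fluct \<eta> = \<eta> - of_int \<lfloor>\<eta>\<rfloor> - 1 / 2"

end

theory Submission
  imports Defs "HOL-Real_Asymp.Real_Asymp"
begin

text \<open>
  The first Riesz mean on the sphere has an exact closed form; the asymptotics is its expansion.

  Let \<open>L\<close> be the integer part of \<open>w\<close>, so that the levels up to \<open>L\<close> are those contributing to
  \<open>R\<^sub>1(z)\<close>, and let \<open>N(L)\<close> be the number of eigenvalues on these levels. The count is a polynomial
  in \<open>L\<close> whose roots are symmetric about \<open>-d/2\<close> (\<open>sum_sphere_mult\<close>), and the average of the
  eigenvalues counted is \<open>d/(d+2) L(L+d)\<close>, hence \<open>R\<^sub>1(z) = N(L) (z - d/(d+2) L(L+d))\<close>
  (\<open>weighted_levels_sum\<close>).

  The variable adapted to the problem is \<open>x = w + (d-1)/2\<close>, for which \<open>z = x\<^sup>2 - k\<close> with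
  \<open>k = ((d-1)/2)\<^sup>2\<close>. The centre of symmetry of the roots turns into \<open>L + d/2 = x - \<psi>(w)\<close>. Thus,
  up to a constant times \<open>x\<close> to the power \<open>d+2\<close>, \<open>R\<^sub>1(z)\<close> is a product of \<open>d\<close> factors \<open>1 + b/x\<close> and one
  quadratic polynomial in \<open>1/x\<close>, all with coefficients that depend on \<open>z\<close> only through the bounded
  quantity \<open>\<psi>(w)\<close> (\<open>riesz_mean_1_factorised\<close>). The change from the power of \<open>x\<close> to the power of
  \<open>z\<close> contributes one further factor \<open>((z+k)/z)\<close> to the power \<open>d/2+1\<close>.

  Expanding the product in \<open>1/x\<close> to second order (\<open>second_order_expansion_mult\<close>), the linear factors
  contribute \<open>-d \<psi>\<close> to the first-order coefficient and the quadratic one contributes \<open>d \<psi>\<close>: the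
  term in \<open>1/x\<close> cancels. What remains at second order is the claimed coefficient, and \<open>1/x\<^sup>2\<close>
  may be replaced by \<open>1/z\<close> since their difference is of order \<open>1/z\<^sup>2\<close>.
\<close>

section \<open>Counting eigenvalues\<close>

text \<open>
  The multiplicity is a difference of binomial coefficients two steps apart, so the sum telescopes
  and leaves the last two of them.
\<close>

lemma sum_sphere_mult_binomial:
  assumes "d \<ge> 1"
  shows "(\<Sum>l\<le>L. real (sphere_mult d l)) = 
    real (d + L choose L) + (if L = 0 then 0 else real (d + L - 1 choose (L - 1)))"
proof (induction L)
  case 0 then show ?case by (simp add: sphere_mult_def)
next
  case (Suc L)
  have "real (sphere_mult d (Suc L)) = 
      real (d + Suc L choose Suc L) - (if Suc L < 2 then 0 else real (d + Suc L - 2 choose (Suc L - 2)))"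
    using sphere_mult_less[OF assms, of "Suc L"] by (auto simp: sphere_mult_def of_nat_diff)
  then show ?case using Suc by (cases L) (auto)
qed

lemma binomial_eq_shifted_product: "real (d + L choose L) = (\<Prod>i=1..d. real L + real i) / fact d"
proof (induction d)
  case 0 show ?case by simp
next
  case (Suc d)
  have "real (Suc d) * real (Suc d + L choose L) = (real L + real (Suc d)) * real (d + L choose L)"
  proof -
    have symmetric: "m + L choose L = m + L choose m" for m
      using binomial_symmetric[of m "m + L"] by simp
    have "Suc d * (Suc d + L choose L) = Suc (d + L) * (d + L choose L)"
      using Suc_times_binomial[of d "d + L"] unfolding symmetric by (simp only: add_Suc)
    then have "real (Suc d * (Suc d + L choose L)) = real (Suc (d + L) * (d + L choose L))"
      by (rule arg_cong)
    then show ?thesis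
      unfolding of_nat_mult by (simp only: of_nat_add of_nat_Suc add_ac)
  qed
  then have "real (Suc d + L choose L) = (real L + real (Suc d)) * real (d + L choose L) / real (Suc d)"
    by (simp only: nonzero_eq_divide_eq of_nat_eq_0_iff nat.distinct not_False_eq_True mult.commute)
  then show ?case
    unfolding Suc.IH by (simp add: mult_ac)
qed

text \<open>
  The two binomial coefficients share the roots \<open>-1, \<dots>, -(d-1)\<close>; their remaining factors
  \<open>L + d\<close> and \<open>L\<close> add up to twice \<open>L + d/2\<close>. All \<open>d\<close> roots are therefore symmetric
  about \<open>-d/2\<close>.
\<close>

lemma sum_sphere_mult:
  assumes "d \<ge> 1"
  shows "(\<Sum>l\<le>L. real (sphere_mult d l)) =
    2 / fact d * (real L + real d / 2) * (\<Prod>i=1..<d. real L + real i)"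
proof -
  obtain n where d: "d = Suc n" using assms by (cases d) auto
  have 1: "real (d + L choose L) = (real L + real d) * (\<Prod>i=1..<d. real L + real i) / fact d"
    unfolding binomial_eq_shifted_product d by (simp add: atLeastLessThanSuc_atLeastAtMost)
  have 2: "(if L = 0 then 0 else real (d + L - 1 choose (L - 1))) = real L * (\<Prod>i=1..<d. real L + real i) / fact d"
  proof (cases L)
    case (Suc l)
    have "(\<Prod>i=1..d. real l + real i) = (\<Prod>i=0..<d. real L + real i)"
      by (rule prod.reindex_bij_witness[of _ Suc "\<lambda>i. i - 1"]) (auto simp: Suc)
    also have "\<dots> = real L * (\<Prod>i=1..<d. real L + real i)"
      using assms by (simp add: prod.atLeast_Suc_lessThan)
    finally show ?thesis using binomial_eq_shifted_product[of d l] Suc by simp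
  qed simp
  show ?thesis unfolding sum_sphere_mult_binomial[OF assms] 1 2 by (simp add: field_simps)
qed

text \<open>
  Induction on \<open>L\<close>. Both sides are affine in \<open>z\<close> with slope \<open>N(L)\<close>, the sum of the
  multiplicities, and when \<open>L\<close> increases the left-hand side gains a term that vanishes at
  \<open>z = \<lambda>\<close>, the value of the new level. So it suffices to compare the right-hand sides for
  \<open>L\<close> and \<open>L + 1\<close> at \<open>z = \<lambda>\<close>, and there the second factors are in the proportion
  \<open>(L+d)(2L+d+2) : (L+1)(2L+d)\<close>, which is exactly the ratio \<open>N(L+1) : N(L)\<close>.
\<close>

lemma weighted_levels_sum:
  assumes "d \<ge> 1"
  shows "(\<Sum>l\<le>L. real (sphere_mult d l) * (z - sphere_level d l)) =
    (\<Sum>l\<le>L. real (sphere_mult d l)) * (z - real d / (real d + 2) * (real L * (real L + real d)))"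
proof (induction L)
  case 0
  then show ?case by (simp add: sphere_level_def)
next
  case (Suc L)
  define N where "N L = (\<Sum>l\<le>L. real (sphere_mult d l))" for L
  define P where "P = (\<Prod>i=1..<d. real L + real i)"
  have mult: "real (sphere_mult d (Suc L)) = N (Suc L) - N L"
    by (simp add: N_def)
  have "(real L + 1) * (\<Prod>i=1..<d. real (Suc L) + real i) = (\<Prod>i=0..<d. real (Suc L) + real i)"
    using assms by (simp add: prod.atLeast_Suc_lessThan)
  also have "\<dots> = (\<Prod>i=1..<Suc d. real L + real i)"
    by (rule prod.reindex_bij_witness[of _ "\<lambda>i. i - 1" Suc]) auto
  also have "\<dots> = P * (real L + real d)"
    using assms by (simp add: P_def)
  finally have shift: "(real L + 1) * (\<Prod>i=1..<d. real (Suc L) + real i) = P * (real L + real d)" .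
  have "(real L + 1) * (2 * real L + real d) * N (Suc L) =
      (real L + 1) * (2 * real L + real d) * (2 / fact d * (real (Suc L) + real d / 2)) * (\<Prod>i=1..<d. real (Suc L) + real i)"
    by (simp add: N_def sum_sphere_mult[OF assms] del: sum.atMost_Suc)
  also have "\<dots> = (2 * real L + real d) * (2 / fact d * (real (Suc L) + real d / 2)) * (P * (real L + real d))"
    unfolding shift[symmetric] by (simp only: mult_ac)
  also have "\<dots> = (real L + real d) * (2 * real L + real d + 2) * (2 / fact d * (real L + real d / 2) * P)"
  proof -
    have "(2 * real L + real d) * (c * (real (Suc L) + real d / 2)) * (P * (real L + real d))
        = (real L + real d) * (2 * real L + real d + 2) * (c * (real L + real d / 2) * P)" for c
      by (simp add: field_simps)
    then show ?thesis .
  qed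
  also have "\<dots> = (real L + real d) * (2 * real L + real d + 2) * N L"
    unfolding N_def sum_sphere_mult[OF assms] P_def ..
  finally have ratio: "(real L + 1) * (2 * real L + real d) * N (Suc L) =
      (real L + real d) * (2 * real L + real d + 2) * N L" .
  define c where "c = real d / (real d + 2)"
  have c: "c * (real d + 2) = real d" by (simp add: c_def)
  have eq: "N (Suc L) * (sphere_level d (Suc L) - c * (real (Suc L) * (real (Suc L) + real d)))
      = N L * (sphere_level d (Suc L) - c * (real L * (real L + real d)))"
  proof -
    have "(real d + 2) * (N (Suc L) * (sphere_level d (Suc L) - c * (real (Suc L) * (real (Suc L) + real d))))
      = N (Suc L) * ((real d + 2) * sphere_level d (Suc L) - (c * (real d + 2)) * (real (Suc L) * (real (Suc L) + real d)))"
      by (simp only: algebra_simps)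
    also have "\<dots> = (real L + 1) * (2 * real L + real d) * N (Suc L)"
      unfolding c by (simp add: sphere_level_def algebra_simps)
    also have "\<dots> = N L * ((real d + 2) * sphere_level d (Suc L) - (c * (real d + 2)) * (real L * (real L + real d)))"
      unfolding c ratio by (simp add: sphere_level_def algebra_simps)
    also have "\<dots> = (real d + 2) * (N L * (sphere_level d (Suc L) - c * (real L * (real L + real d))))"
      by (simp only: algebra_simps)
    finally show ?thesis by simp
  qed
  have "(\<Sum>l\<le>Suc L. real (sphere_mult d l) * (z - sphere_level d l)) =
     N L * (z - c * (real L * (real L + real d))) + (N (Suc L) - N L) * (z - sphere_level d (Suc L))"
    unfolding sum.atMost_Suc Suc.IH by (simp only: mult N_def c_def)
  also have "\<dots> = N (Suc L) * (z - c * (real (Suc L) * (real (Suc L) + real d)))"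
    using eq by algebra
  finally show ?case by (simp only: N_def c_def)
qed

lemma sphere_level_mono:
  assumes "d \<ge> 1" "a \<le> b"
  shows "sphere_level d a \<le> sphere_level d b"
  unfolding sphere_level_def using assms by (intro mult_mono) auto

text \<open>
  Grouping the series by levels. A level equal to \<open>z\<close> contributes nothing, which is why \<open>z\<close> may
  range over an interval closed at both ends.
\<close>

lemma riesz_mean_1_eq_sum_levels:
  assumes d: "d \<ge> 1" and le: "sphere_level d L \<le> z" and ge: "z \<le> sphere_level d (Suc L)"
  shows "riesz_mean_1 d z = (\<Sum>l\<le>L. real (sphere_mult d l) * (z - sphere_level d l))"
proof -
  define A where "A l = {j. sphere_eigenvalue d j = sphere_level d l}" for l
  have fin: "finite (A l)" for l
    using card_sphere_eigenvalue[OF d, of l] sphere_mult_pos[OF d, of l] unfolding A_def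
    by (metis card.infinite less_not_refl)
  have "max (z - sphere_eigenvalue d j) 0 = 0" if "j \<notin> (\<Union>l\<le>L. A l)" for j
  proof -
    obtain l where l: "sphere_eigenvalue d j = sphere_level d l" by (auto simp: sphere_eigenvalue_def)
    then have "Suc L \<le> l" using that by (auto simp: A_def not_le[symmetric])
    from ge sphere_level_mono[OF d this] show ?thesis using l by simp
  qed
  then have "riesz_mean_1 d z = (\<Sum>j\<in>(\<Union>l\<le>L. A l). max (z - sphere_eigenvalue d j) 0)"
    unfolding riesz_mean_1_def using fin by (intro suminf_finite) auto
  also have "\<dots> = (\<Sum>l\<le>L. \<Sum>j\<in>A l. max (z - sphere_eigenvalue d j) 0)"
    using fin by (intro sum.UNION_disjoint) (auto simp: A_def sphere_level_inject[OF d])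
  also have "\<dots> = (\<Sum>l\<le>L. real (sphere_mult d l) * (z - sphere_level d l))"
  proof (intro sum.cong refl)
    fix l assume "l \<in> {..L}"
    then have "sphere_level d l \<le> z" using sphere_level_mono[OF d, of l L] le by simp
    then have "(\<Sum>j\<in>A l. max (z - sphere_eigenvalue d j) 0) = (\<Sum>j\<in>A l. z - sphere_level d l)"
      by (intro sum.cong) (auto simp: A_def)
    then show "(\<Sum>j\<in>A l. max (z - sphere_eigenvalue d j) 0) = real (sphere_mult d l) * (z - sphere_level d l)"
      using card_sphere_eigenvalue[OF d, of l] by (simp add: A_def)
  qed
  finally show ?thesis .
qed

section \<open>The Riesz mean as an explicit product\<close>

text \<open>
  With \<open>L\<close> the integer part of \<open>u\<close> one has \<open>x - s = L + d/2\<close>, because the fluctuation is the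
  fractional part minus \<open>1/2\<close>. Measured from \<open>-d/2\<close>, the centre of symmetry of the roots of the
  count, the product \<open>L(L+d)\<close> becomes a difference of two squares.
\<close>

lemma riesz_mean_1_closed_form:
  fixes d :: nat and u :: real
  assumes d: "d \<ge> 1" and u: "u \<ge> 0"
  defines "x \<equiv> u + (real d - 1) / 2" and "s \<equiv> fluct u"
  shows "riesz_mean_1 d (u * (u + real d - 1)) =
    2 / fact d * (x - s) * (\<Prod>i=1..<d. x + (real i - real d / 2 - s)) *
    (u * (u + real d - 1) - real d / (real d + 2) * ((x - s)\<^sup>2 - (real d / 2)\<^sup>2))"
proof -
  define L where "L = nat \<lfloor>u\<rfloor>"
  have L: "real L = x - s - real d / 2"
    using u by (simp add: L_def x_def s_def fluct_def field_simps)
  have "sphere_level d L \<le> u * (u + real d - 1)"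
  proof -
    have "real L \<le> u" using u by (simp add: L_def)
    then show ?thesis
      unfolding sphere_level_def using d u by (intro mult_mono) auto
  qed
  moreover have "u * (u + real d - 1) \<le> sphere_level d (Suc L)"
  proof -
    have "u \<le> real (Suc L)" using u unfolding L_def by linarith
    then show ?thesis
      unfolding sphere_level_def using d u by (intro mult_mono) auto
  qed
  moreover have "real L * (real L + real d) = (x - s)\<^sup>2 - (real d / 2)\<^sup>2"
    unfolding L by (simp add: power2_eq_square algebra_simps)
  moreover have "real L + real i = x + (real i - real d / 2 - s)" for i
    unfolding L by simp
  moreover have "real L + real d / 2 = x - s"
    unfolding L by simp
  ultimately show ?thesis
    by (simp only: riesz_mean_1_eq_sum_levels[OF d] weighted_levels_sum[OF d] sum_sphere_mult[OF d])
qed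

text \<open>
  Taking a factor \<open>x\<close> out of each linear factor of the closed form, and \<open>x\<^sup>2\<close> out of the last
  factor, leaves polynomials in \<open>1/x\<close> with constant term 1; the constant in front is the product of
  the semiclassical constant and the volume of the sphere.
\<close>

lemma riesz_mean_1_factorised:
  fixes d :: nat and u :: real
  assumes d: "d \<ge> 1" and u: "u \<ge> 0" and x0: "u + (real d - 1) / 2 > 0"
  defines "x \<equiv> u + (real d - 1) / 2" and "s \<equiv> fluct u"
  shows "riesz_mean_1 d (u * (u + real d - 1)) =
    4 / ((real d + 2) * fact d) * x ^ (d + 2) *
    ((1 + - s * (1 / x)) * (\<Prod>i=1..<d. 1 + (real i - real d / 2 - s) * (1 / x)) *
     (1 + real d * s * (1 / x) + ((3 * real d - 2) / 8 - real d * s\<^sup>2 / 2) * (1 / x)\<^sup>2))"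
proof -
  have x: "x > 0" using x0 by (simp add: x_def)
  have u_eq: "u * (u + real d - 1) = x\<^sup>2 - ((real d - 1) / 2)\<^sup>2"
    by (simp add: x_def power2_eq_square field_simps)
  have 1: "x - s = x * (1 + - s * (1 / x))" using x by (simp add: field_simps)
  have "(\<Prod>i=1..<d. x + (real i - real d / 2 - s)) = (\<Prod>i=1..<d. x * (1 + (real i - real d / 2 - s) * (1 / x)))"
    using x by (intro prod.cong) (auto simp: field_simps)
  then have 2: "(\<Prod>i=1..<d. x + (real i - real d / 2 - s))
      = x ^ (d - 1) * (\<Prod>i=1..<d. 1 + (real i - real d / 2 - s) * (1 / x))"
    unfolding prod.distrib by simp
  have "(real d + 2) * (x\<^sup>2 - ((real d - 1) / 2)\<^sup>2 - real d / (real d + 2) * ((x - s)\<^sup>2 - (real d / 2)\<^sup>2))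
      = (real d + 2) * (x\<^sup>2 - ((real d - 1) / 2)\<^sup>2) - real d * ((x - s)\<^sup>2 - (real d / 2)\<^sup>2)"
    by (simp add: right_diff_distrib)
  also have "\<dots> = 2 * (x\<^sup>2 + real d * s * x + ((3 * real d - 2) / 8 - real d * s\<^sup>2 / 2))"
    by (simp add: power2_eq_square field_simps)
  also have "\<dots> = 2 * x\<^sup>2 * (1 + real d * s * (1 / x) + ((3 * real d - 2) / 8 - real d * s\<^sup>2 / 2) * (1 / x)\<^sup>2)"
  proof -
    have "x\<^sup>2 + a * x + b = x\<^sup>2 * (1 + a * (1 / x) + b * (1 / x)\<^sup>2)" for a b
      using x by (simp add: power2_eq_square field_simps)
    from this[of "real d * s" "(3 * real d - 2) / 8 - real d * s\<^sup>2 / 2"] show ?thesis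
      by (simp only: mult.assoc)
  qed
  finally have "(real d + 2) * (u * (u + real d - 1) - real d / (real d + 2) * ((x - s)\<^sup>2 - (real d / 2)\<^sup>2)) = \<dots>"
    unfolding u_eq .
  then have 3: "u * (u + real d - 1) - real d / (real d + 2) * ((x - s)\<^sup>2 - (real d / 2)\<^sup>2)
      = 2 / (real d + 2) * x\<^sup>2 *
        (1 + real d * s * (1 / x) + ((3 * real d - 2) / 8 - real d * s\<^sup>2 / 2) * (1 / x)\<^sup>2)"
    (is "?lhs = 2 / _ * _ * ?c")
    by (metis (no_types, opaque_lifting) nonzero_mult_div_cancel_left of_nat_0_le_iff
        add_nonneg_pos zero_less_numeral less_irrefl times_divide_eq_left)
  have pow: "x * x ^ (d - 1) * x\<^sup>2 = x ^ (d + 2)"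
    unfolding power_add using d by (cases d) simp_all
  have "riesz_mean_1 d (u * (u + real d - 1)) =
    2 / fact d * (x - s) * (\<Prod>i=1..<d. x + (real i - real d / 2 - s)) * ?lhs"
    using riesz_mean_1_closed_form[OF d u] by (simp only: x_def s_def)
  also have "\<dots> = 2 / fact d * (2 / (real d + 2)) * (x * x ^ (d - 1) * x\<^sup>2) *
      ((1 + - s * (1 / x)) * (\<Prod>i=1..<d. 1 + (real i - real d / 2 - s) * (1 / x)) * ?c)"
    unfolding 2 3 by (subst 1) (simp only: mult_ac)
  also have "2 / fact d * (2 / (real d + 2)) = 4 / ((real d + 2) * fact d)"
    by simp
  finally show ?thesis unfolding pow .
qed

section \<open>Second-order expansions with bounded coefficients\<close>

text \<open>
  The coefficients \<open>p\<close> and \<open>q\<close> are functions and not constants, because the fluctuation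
  oscillates without converging; boundedness is what keeps the error terms uniform.
\<close>

definition second_order_expansion ::
  "'a filter \<Rightarrow> ('a \<Rightarrow> real) \<Rightarrow> ('a \<Rightarrow> real) \<Rightarrow> ('a \<Rightarrow> real) \<Rightarrow> ('a \<Rightarrow> real) \<Rightarrow> bool" where
  "second_order_expansion F e f p q \<longleftrightarrow> p \<in> O[F](\<lambda>_. 1) \<and> q \<in> O[F](\<lambda>_. 1) \<and>
     (\<lambda>z. f z - (1 + p z * e z + q z * (e z)\<^sup>2)) \<in> o[F](\<lambda>z. (e z)\<^sup>2)"

lemma second_order_expansion_mult:
  assumes e: "(e \<longlongrightarrow> 0) F"
    and f: "second_order_expansion F e f p q"
    and g: "second_order_expansion F e g r s"
  shows "second_order_expansion F e (\<lambda>z. f z * g z) (\<lambda>z. p z + r z) (\<lambda>z. q z + s z + p z * r z)"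
proof -
  have b: "p \<in> O[F](\<lambda>_. 1)" "q \<in> O[F](\<lambda>_. 1)" "r \<in> O[F](\<lambda>_. 1)" "s \<in> O[F](\<lambda>_. 1)"
    using f g by (auto simp: second_order_expansion_def)
  have m: "(\<lambda>z. u z * v z) \<in> O[F](\<lambda>_. 1)" if "u \<in> O[F](\<lambda>_. 1)" "v \<in> O[F](\<lambda>_. 1)" for u v :: "'a \<Rightarrow> real"
    using landau_o.big.mult[OF that] by simp
  have e1: "e \<in> o[F](\<lambda>_. 1)"
    using e by (simp add: smalloI_tendsto)
  have eO: "e \<in> O[F](\<lambda>_. 1)" using e1 by (rule landau_o.small_imp_big)
  define A where "A = (\<lambda>z. 1 + p z * e z + q z * (e z)\<^sup>2)"
  define B where "B = (\<lambda>z. 1 + r z * e z + s z * (e z)\<^sup>2)"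
  have AO: "A \<in> O[F](\<lambda>_. 1)" and BO: "B \<in> O[F](\<lambda>_. 1)"
    unfolding A_def B_def power2_eq_square by (intro sum_in_bigo m b eO; simp)+
  have fA: "(\<lambda>z. f z - A z) \<in> o[F](\<lambda>z. (e z)\<^sup>2)" and gB: "(\<lambda>z. g z - B z) \<in> o[F](\<lambda>z. (e z)\<^sup>2)"
    using f g by (auto simp: second_order_expansion_def A_def B_def)
  have gO: "g \<in> O[F](\<lambda>_. 1)"
  proof -
    have "(\<lambda>z. (e z)\<^sup>2) \<in> O[F](\<lambda>_. 1)" unfolding power2_eq_square by (intro m eO)
    from landau_o.big_trans[OF landau_o.small_imp_big[OF gB] this]
    have "(\<lambda>z. (g z - B z) + B z) \<in> O[F](\<lambda>_. 1)" by (rule sum_in_bigo) (rule BO)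
    then show ?thesis by simp
  qed
  have t1: "(\<lambda>z. (f z - A z) * g z) \<in> o[F](\<lambda>z. (e z)\<^sup>2)"
    using landau_o.small_big_mult[OF fA gO] by simp
  have t2: "(\<lambda>z. (g z - B z) * A z) \<in> o[F](\<lambda>z. (e z)\<^sup>2)"
    using landau_o.small_big_mult[OF gB AO] by simp
  have "(\<lambda>z. e z * (p z * s z + q z * r z + q z * s z * e z)) \<in> o[F](\<lambda>_. 1)"
    using landau_o.small_big_mult[OF e1, of "\<lambda>z. p z * s z + q z * r z + q z * s z * e z" "\<lambda>_. 1"]
    by (simp add: sum_in_bigo m b eO)
  from landau_o.small_big_mult[OF this landau_o.big_refl[of "\<lambda>z. (e z)\<^sup>2"]]
  have t3: "(\<lambda>z. e z * (p z * s z + q z * r z + q z * s z * e z) * (e z)\<^sup>2) \<in> o[F](\<lambda>z. (e z)\<^sup>2)"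
    by simp
  \<comment> \<open>The last summand collects the terms of orders three and four of the product of the two polynomials.\<close>
  have "f z * g z - (1 + (p z + r z) * e z + (q z + s z + p z * r z) * (e z)\<^sup>2)
      = (f z - A z) * g z + (g z - B z) * A z
        + e z * (p z * s z + q z * r z + q z * s z * e z) * (e z)\<^sup>2" for z
    unfolding A_def B_def by algebra
  then show ?thesis
    unfolding second_order_expansion_def using b by (simp only:) (intro conjI sum_in_bigo sum_in_smallo m t1 t2 t3)
qed

text \<open>
  The second-order coefficient is the second elementary symmetric polynomial of the \<open>b i\<close>, written
  in power sums because those are easy to evaluate for equally spaced values.
\<close>

lemma second_order_expansion_prod:
  assumes e: "(e \<longlongrightarrow> 0) F" and "finite I" and "\<And>i. i \<in> I \<Longrightarrow> b i \<in> O[F](\<lambda>_. 1)"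
  shows "second_order_expansion F e (\<lambda>z. \<Prod>i\<in>I. 1 + b i z * e z) (\<lambda>z. \<Sum>i\<in>I. b i z)
           (\<lambda>z. ((\<Sum>i\<in>I. b i z)\<^sup>2 - (\<Sum>i\<in>I. (b i z)\<^sup>2)) / 2)"
  using assms(2,3)
proof (induction I rule: finite_induct)
  case empty
  then show ?case by (simp add: second_order_expansion_def)
next
  case (insert i I)
  have "second_order_expansion F e (\<lambda>z. 1 + b i z * e z) (b i) (\<lambda>_. 0)"
    using insert by (simp add: second_order_expansion_def)
  from second_order_expansion_mult[OF e this insert.IH] insert
  show ?case
    by (simp add: power2_eq_square algebra_simps add_divide_distrib diff_divide_distrib)
qed

lemma second_order_expansion_shift_powr:
  fixes k a :: real
  shows "second_order_expansion at_top (\<lambda>z. 1 / sqrt (z + k)) (\<lambda>z. ((z + k) / z) powr a)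
    (\<lambda>_. 0) (\<lambda>_. a * k)"
  unfolding second_order_expansion_def by (simp, real_asymp)

text \<open>
  Without a first-order term only the square of the small parameter enters, that is
  \<open>1/(z+k)\<close>, which is \<open>1/z\<close> up to an error of order \<open>1/z\<^sup>2\<close>.
\<close>

lemma second_order_expansion_in_reciprocal:
  fixes k :: real
  assumes "second_order_expansion at_top (\<lambda>z. 1 / sqrt (z + k)) f (\<lambda>_. 0) q"
  shows "(\<lambda>z. f z - (1 + q z * (1 / z))) \<in> o[at_top](\<lambda>z. 1 / z)"
proof -
  let ?e = "\<lambda>z. 1 / sqrt (z + k)"
  have 1: "(\<lambda>z. (?e z)\<^sup>2) \<in> O[at_top](\<lambda>z. 1 / z)"
    by real_asymp
  have 2: "(\<lambda>z. (?e z)\<^sup>2 - 1 / z) \<in> o[at_top](\<lambda>z. 1 / z)"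
    by real_asymp
  have q: "q \<in> O[at_top](\<lambda>_. 1)"
    and f: "(\<lambda>z. f z - (1 + 0 * ?e z + q z * (?e z)\<^sup>2)) \<in> o[at_top](\<lambda>z. (?e z)\<^sup>2)"
    using assms by (simp_all add: second_order_expansion_def)
  have "(\<lambda>z. ((?e z)\<^sup>2 - 1 / z) * q z) \<in> o[at_top](\<lambda>z. 1 / z)"
    using landau_o.small_big_mult[OF 2 q] by simp
  with landau_o.small_big_trans[OF f 1]
  have "(\<lambda>z. (f z - (1 + 0 * ?e z + q z * (?e z)\<^sup>2)) + ((?e z)\<^sup>2 - 1 / z) * q z) \<in> o[at_top](\<lambda>z. 1 / z)"
    by (rule sum_in_smallo)
  then show ?thesis by (simp add: algebra_simps)
qed

section \<open>Asymptotics of the Riesz mean\<close>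

text \<open>
  The unshifted values \<open>i - d/2\<close> are symmetric about 0, so a shift by \<open>s\<close> enters the second
  power sum only through \<open>s\<^sup>2\<close>.
\<close>

lemma sum_centred_roots:
  assumes "d \<ge> 1"
  shows "(\<Sum>i=1..<d. real i - real d / 2 - s) = - (real d - 1) * s"
    and "(\<Sum>i=1..<d. (real i - real d / 2 - s)\<^sup>2)
           = real d * (real d - 1) * (real d - 2) / 12 + (real d - 1) * s\<^sup>2"
proof -
  obtain n where d: "d = Suc n" using assms by (cases d) auto
  have 1: "(\<Sum>i=1..<Suc n. real i - c) = real n * (real n + 1) / 2 - real n * c" for c
    by (induction n) (auto simp: field_simps)
  have 2: "(\<Sum>i=1..<Suc n. (real i - c)\<^sup>2) = real n * (real n + 1) * (2 * real n + 1) / 6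
      - c * real n * (real n + 1) + real n * c\<^sup>2" for c
    by (induction n) (auto simp: field_simps power2_eq_square)
  have shift: "real i - real d / 2 - s = real i - (real d / 2 + s)" for i by simp
  show "(\<Sum>i=1..<d. real i - real d / 2 - s) = - (real d - 1) * s"
    unfolding shift unfolding d 1 by (simp add: field_simps)
  show "(\<Sum>i=1..<d. (real i - real d / 2 - s)\<^sup>2)
           = real d * (real d - 1) * (real d - 2) / 12 + (real d - 1) * s\<^sup>2"
    unfolding shift unfolding d 2 by (simp add: field_simps power2_eq_square)
qed

theorem theorem4p1p1:
  fixes d :: nat and w :: "real \<Rightarrow> real"
  assumes "d \<ge> 2"
    and "\<And>z. z \<ge> 0 \<Longrightarrow> w z \<ge> 0"
    and "\<And>z. z \<ge> 0 \<Longrightarrow> w z * (w z + real d - 1) = z"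
  shows "(\<lambda>z. riesz_mean_1 d z / (L_class 1 d * sphere_volume d * z powr (real d / 2 + 1))
            - (1 + real d * (real d + 2) / 12
                   * (real d - 2 + 6 * (1 / 4 - (fluct (w z))\<^sup>2)) * (1 / z)))
         \<in> o[at_top](\<lambda>z. 1 / z)"
proof -
  define k where "k = ((real d - 1) / 2)\<^sup>2"
  define e where "e = (\<lambda>z. 1 / sqrt (z + k))"
  define s where "s = (\<lambda>z. fluct (w z))"
  define P where "P = (\<lambda>z. \<Prod>i=1..<d. 1 + (real i - real d / 2 - s z) * e z)"
  define c where "c = (\<lambda>z. (3 * real d - 2) / 8 - real d * (s z)\<^sup>2 / 2)"
  \<comment> \<open>For positive \<open>z\<close>, \<open>G z\<close> is the normalised Riesz mean and \<open>e z\<close> the reciprocal of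
    \<open>w z + (d - 1)/2\<close>; \<open>Q\<close> is the coefficient to be found.\<close>
  define G where "G = (\<lambda>z. (1 + - s z * e z) * P z * (1 + real d * s z * e z + c z * (e z)\<^sup>2)
    * ((z + k) / z) powr (real d / 2 + 1))"
  define Q where "Q = (\<lambda>z. real d * (real d + 2) / 12 * (real d - 2 + 6 * (1 / 4 - (s z)\<^sup>2)))"
  have k: "k \<ge> 0" by (simp add: k_def)
  have d: "d \<ge> 1" using assms(1) by simp
  have e0: "(e \<longlongrightarrow> 0) at_top" unfolding e_def by real_asymp
  have sO: "s \<in> O[at_top](\<lambda>_. 1)"
  proof (rule bigoI[where c = "1/2"], rule always_eventually, rule allI)
    fix z show "norm (s z) \<le> 1 / 2 * norm (1 :: real)"
      unfolding s_def fluct_def real_norm_def by linarith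
  qed
  have bd: "(\<lambda>z. a - s z) \<in> O[at_top](\<lambda>_. 1)"
    "(\<lambda>z. - s z) \<in> O[at_top](\<lambda>_. 1)" "(\<lambda>z. a * s z) \<in> O[at_top](\<lambda>_. 1)" for a
    using sO by (auto intro!: sum_in_bigo)
  have cO: "c \<in> O[at_top](\<lambda>_. 1)"
    using landau_o.big.mult[OF sO sO] by (auto simp: c_def power2_eq_square intro!: sum_in_bigo)
  have "second_order_expansion at_top e P (\<lambda>z. \<Sum>i=1..<d. real i - real d / 2 - s z)
           (\<lambda>z. ((\<Sum>i=1..<d. real i - real d / 2 - s z)\<^sup>2
              - (\<Sum>i=1..<d. (real i - real d / 2 - s z)\<^sup>2)) / 2)"
    unfolding P_def by (intro second_order_expansion_prod e0 bd) auto
  note E2 = this[unfolded sum_centred_roots[OF d]]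
  have E1: "second_order_expansion at_top e (\<lambda>z. 1 + - s z * e z) (\<lambda>z. - s z) (\<lambda>_. 0)"
    using bd by (simp add: second_order_expansion_def)
  have E3: "second_order_expansion at_top e (\<lambda>z. 1 + real d * s z * e z + c z * (e z)\<^sup>2) 
      (\<lambda>z. real d * s z) c"
    using bd cO by (simp add: second_order_expansion_def)
  have E4: "second_order_expansion at_top e (\<lambda>z. ((z + k) / z) powr (real d / 2 + 1)) 
      (\<lambda>_. 0) (\<lambda>_. (real d / 2 + 1) * k)"
    unfolding e_def by (rule second_order_expansion_shift_powr)
  have "second_order_expansion at_top e G (\<lambda>_. 0) Q"
  proof -
    \<comment> \<open>The coefficients that the product rule assigns to the four factors multiplied from left to right:
      at first order they cancel, at second order they add up to \<open>Q\<close>.\<close>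
    have p: "- s z + - (real d - 1) * s z + real d * s z + 0 = 0" for z
      by (simp add: algebra_simps)
    have q: "0 + ((- (real d - 1) * s z)\<^sup>2
          - (real d * (real d - 1) * (real d - 2) / 12 + (real d - 1) * (s z)\<^sup>2)) / 2
        + - s z * (- (real d - 1) * s z) + c z + (- s z + - (real d - 1) * s z) * (real d * s z)
        + (real d / 2 + 1) * k + (- s z + - (real d - 1) * s z + real d * s z) * 0 = Q z" for z
      by (simp add: Q_def c_def k_def field_simps power2_eq_square)
    show ?thesis
      using second_order_expansion_mult[OF e0 second_order_expansion_mult[OF e0
            second_order_expansion_mult[OF e0 E1 E2] E3] E4]
      unfolding p q G_def .
  qed
  then have "(\<lambda>z. G z - (1 + Q z * (1 / z))) \<in> o[at_top](\<lambda>z. 1 / z)"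
    unfolding e_def by (rule second_order_expansion_in_reciprocal)
  moreover have "eventually (\<lambda>z. G z =
      riesz_mean_1 d z / (L_class 1 d * sphere_volume d * z powr (real d / 2 + 1))) at_top"
    using eventually_gt_at_top[of 0]
  proof eventually_elim
    case (elim z)
    define u where "u = w z"
    define x where "x = u + (real d - 1) / 2"
    have u: "u \<ge> 0" "u * (u + real d - 1) = z"
      using assms(2,3)[of z] elim by (auto simp: u_def)
    have x: "x > 0" using u assms(1) by (simp add: x_def add_nonneg_pos)
    have "z + k = x\<^sup>2"
      using u(2) by (simp add: x_def k_def power2_eq_square field_simps)
    then have sqrt: "sqrt (z + k) = x" using x by simp
    have "x ^ (d + 2) = (z + k) powr (real (d + 2) * (1 / 2))"
      using elim k by (simp only: sqrt[symmetric] powr_half_sqrt[symmetric] powr_power powr_powr)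
    also have "\<dots> = (z + k) powr (real d / 2 + 1)"
      by (simp add: add_divide_distrib add.commute)
    also have "\<dots> = ((z + k) / z) powr (real d / 2 + 1) * z powr (real d / 2 + 1)"
      using elim k by (simp flip: powr_mult)
    finally have pow: "x ^ (d + 2) = \<dots>" .
    have "riesz_mean_1 d z = 4 / ((real d + 2) * fact d) * (G z * z powr (real d / 2 + 1))"
      using riesz_mean_1_factorised[OF d u(1) x[unfolded x_def]]
      unfolding u(2) x_def[symmetric] pow G_def P_def c_def e_def sqrt s_def u_def[symmetric]
      by (simp only: mult_ac)
    then show ?case
      using elim by (simp add: L_class_1_sphere_volume)
  qed
  ultimately show ?thesis
    by (subst (asm) landau_o.small.in_cong) (auto simp: Q_def s_def elim!: eventually_mono)
qed

end
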